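(* Let $n \ge 8$ be an integer. Then the Tyler tree $\mathbb{T}_n$ of height $n$ is not long-repetition-free $2$-colorable.
   Context: In a rooted tree with root $r$, the $j$-th generation is the set of vertices at distance $j$ from $r$ (so the $0$-th generation is $\{r\}$), and the children of a vertex $v$ are the neighbours of $v$ other than the one on the path from $v$ to $r$. The Tyler tree of height $n$, denoted $\mathbb{T}_n$, is the rooted tree with root $r$ in which each vertex in the $j$-th generation has exactly $2^{n-j}+1$ children, for every $0 \le j \le n-1$, and the vertices of the $n$-th generation have no children. A word $\bar w$ is a long square if $\bar w = \bar u\bar u$ for some word $\bar u$ with $|\bar u| \ge 3$. A word is long-square-free if it contains no sub-word (that is, no block of consecutive letters) that is a long square. A simple connected graph $G=(V,E)$ is long-repetition-free $k$-colorable if there exists a coloring $\chi : V \to \{1,\dots,k\}$ (any map; adjacent vertices may receive the same color) such that for every path in $G$ with successive vertices $u_1,\dots,u_m$ (a path has pairwise distinct vertices), the word $\chi(u_1)\cdots\chi(u_m)$ is long-square-free. *)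

theory Defs
  imports "Graph_Theory.Graph_Theory" "HOL-Library.Sublist"
begin

text \<open>
  A simple undirected graph is a symmetric, loop-free pair digraph
  (\<^locale>\<open>pair_bidirected_digraph\<close>); a path with successive vertices
  \<open>u\<^sub>1, \<dots>, u\<^sub>m\<close> is a list satisfying \<^const>\<open>vpath\<close>.
\<close>

text \<open>
  The constant \<^const>\<open>tree\<close> of the library is unsuitable for undirected graphs: in a
  symmetric digraph, traversing an edge back and forth counts as a \<open>cycle\<close>. Undirected
  cycles are those with at least three edges.
\<close>
definition undirected_tree :: "'a pair_pre_digraph \<Rightarrow> bool" where
  "undirected_tree G \<longleftrightarrow>
     pair_bidirected_digraph G \<and> connected (with_proj G) \<and>
     \<not> (\<exists>c. pre_digraph.cycle (with_proj G) c \<and> 3 \<le> length c)"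

definition graph_dist :: "'a pair_pre_digraph \<Rightarrow> 'a \<Rightarrow> 'a \<Rightarrow> nat" where
  "graph_dist G u v =
     (LEAST k. \<exists>p. vwalk p (with_proj G) \<and> hd p = u \<and> last p = v \<and> vwalk_length p = k)"

definition generation :: "'a pair_pre_digraph \<Rightarrow> 'a \<Rightarrow> nat \<Rightarrow> 'a set" where
  "generation G r j = {v \<in> pverts G. graph_dist G r v = j}"

definition children :: "'a pair_pre_digraph \<Rightarrow> 'a \<Rightarrow> 'a \<Rightarrow> 'a set" where
  "children G r v =
     {w. (v, w) \<in> parcs G \<and>
         \<not> (\<exists>p. vpath p (with_proj G) \<and> hd p = v \<and> last p = r \<and> w \<in> set p)}"

definition tyler_tree :: "nat \<Rightarrow> 'a pair_pre_digraph \<Rightarrow> 'a \<Rightarrow> bool" where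
  "tyler_tree n G r \<longleftrightarrow>
     undirected_tree G \<and> r \<in> pverts G \<and>
     (\<forall>j<n. \<forall>v\<in>generation G r j. card (children G r v) = 2 ^ (n - j) + 1) \<and>
     (\<forall>v\<in>generation G r n. children G r v = {})"

definition long_square :: "'c list \<Rightarrow> bool" where
  "long_square w \<longleftrightarrow> (\<exists>u. w = u @ u \<and> 3 \<le> length u)"

definition long_square_free :: "'c list \<Rightarrow> bool" where
  "long_square_free w \<longleftrightarrow> \<not> (\<exists>v. sublist v w \<and> long_square v)"

definition long_repetition_free_colorable :: "nat \<Rightarrow> 'a pair_pre_digraph \<Rightarrow> bool" where
  "long_repetition_free_colorable k G \<longleftrightarrow>
     (\<exists>\<chi>. (\<forall>v\<in>pverts G. \<chi> v \<in> {1..k}) \<and>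
          (\<forall>p. vpath p (with_proj G) \<longrightarrow> long_square_free (map \<chi> p)))"

end

theory Submission
  imports Defs
begin

text \<open>
  By the pigeonhole principle, applied from the leaves upwards, every vertex with \<open>k\<close>
  generations below it is the root of a complete binary subtree of height \<open>k\<close> whose colour
  depends only on the generation: a vertex with more than \<open>2\<^sup>k\<close> children has two children whose
  subtrees of height \<open>k - 1\<close> carry the same colour word of length \<open>k\<close>. If such a subtree has
  colour word \<open>w\<close>, then for every suffix \<open>c u\<close> of \<open>w\<close> the tree contains a path coloured by the
  palindrome \<open>u\<^sup>R c u\<close>, which climbs one branch and descends another. A finite
  search shows that for each of the binary words \<open>w\<close> of length 9 one of these palindromes contains
  a long square.
\<close>

section \<open>Squares in folded words\<close>

text \<open>Failing on lists that run out before \<open>m\<close> letters ensures that agreement of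
  \<open>w\<close> with \<open>drop m w\<close> yields two complete blocks of length
  \<open>m\<close>.\<close>

fun agree :: "nat \<Rightarrow> 'c list \<Rightarrow> 'c list \<Rightarrow> bool" where
  "agree 0 xs ys \<longleftrightarrow> True"
| "agree (Suc m) (x # xs) (y # ys) \<longleftrightarrow> x = y \<and> agree m xs ys"
| "agree (Suc m) _ _ \<longleftrightarrow> False"

lemma agree_imp_take_eq: "agree m xs ys \<Longrightarrow> take m xs = take m ys \<and> m \<le> length ys"
  by (induction m xs ys rule: agree.induct) auto

text \<open>The last argument is always \<open>drop m w\<close>; it is passed along to speed up evaluation.\<close>
fun has_square_prefix :: "nat \<Rightarrow> 'c list \<Rightarrow> 'c list \<Rightarrow> bool" where
  "has_square_prefix m w [] \<longleftrightarrow> False"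
| "has_square_prefix m w (y # ys) \<longleftrightarrow> agree m w (y # ys) \<or> has_square_prefix (Suc m) w ys"

text \<open>The recursion moves the left end of the square. Half-lengths are tried from 3 on, and
  \<open>drop 2 xs\<close> is \<open>drop 3 (x # xs)\<close>.\<close>

fun has_long_square :: "'c list \<Rightarrow> bool" where
  "has_long_square [] \<longleftrightarrow> False"
| "has_long_square (x # xs) \<longleftrightarrow>
     has_square_prefix 3 (x # xs) (drop 2 xs) \<or> has_long_square xs"

lemma has_square_prefix_sound:
  assumes "has_square_prefix m w ys" and "ys = drop m w"
  shows "\<exists>k\<ge>m. agree k w (drop k w)"
  using assms
proof (induction m w ys rule: has_square_prefix.induct)
  case (2 m w y ys)
  have "ys = drop (Suc m) w"
    using "2.prems"(2) by (metis drop_Suc list.sel(3) tl_drop)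
  with 2 show ?case
    by (metis Suc_leD has_square_prefix.simps(2) order_refl)
qed simp

lemma has_long_square_imp_not_long_square_free:
  assumes "has_long_square w"
  shows "\<not> long_square_free w"
  using assms
proof (induction w)
  case (Cons x xs)
  show ?case
  proof (cases "has_long_square xs")
    case True
    then show ?thesis
      using Cons.IH unfolding long_square_free_def by (meson sublist_Cons_right)
  next
    case False
    let ?w = "x # xs"
    have "has_square_prefix 3 ?w (drop 3 ?w)"
      using Cons.prems False by (simp add: drop_Cons' numeral_3_eq_3 numeral_2_eq_2)
    then obtain k where k: "3 \<le> k" "agree k ?w (drop k ?w)"
      using has_square_prefix_sound by blast
    then have eq: "take k ?w = take k (drop k ?w)" and "k \<le> length (drop k ?w)"
      using agree_imp_take_eq by blast+
    then have "length (take k ?w) = k"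
      by simp
    moreover have "take (k + k) ?w = take k ?w @ take k ?w"
      using eq by (simp only: take_add)
    ultimately have "long_square (take (k + k) ?w)"
      unfolding long_square_def using k(1) by metis
    then show ?thesis
      unfolding long_square_free_def using sublist_take by blast
  qed
qed simp

text \<open>
  Words are extended to the left, so that a square found for \<open>w\<close> settles all words with
  suffix \<open>w\<close> at once.
\<close>
fun fold_search :: "nat \<Rightarrow> nat list \<Rightarrow> bool" where
  "fold_search k w \<longleftrightarrow> has_long_square (rev (tl w) @ w) \<or>
     (case k of 0 \<Rightarrow> False | Suc k' \<Rightarrow> fold_search k' (1 # w) \<and> fold_search k' (2 # w))"

declare fold_search.simps [simp del]

text \<open>The search prepends letters, so the letter it reads next is the last one of
  \<open>vs\<close>; hence the induction from the right with \<open>w\<close> arbitrary. Where the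
  search stops, the current \<open>w\<close> serves as \<open>u\<close>.\<close>

lemma fold_search_sound:
  assumes "fold_search (length vs) w" and "set vs \<subseteq> {1..2}"
  shows "\<exists>u. suffix u (vs @ w) \<and> \<not> long_square_free (rev (tl u) @ u)"
  using assms
proof (induction vs arbitrary: w rule: rev_induct)
  case Nil
  then show ?case
    using has_long_square_imp_not_long_square_free by (auto simp: fold_search.simps[of 0])
next
  case (snoc c vs)
  show ?case
  proof (cases "has_long_square (rev (tl w) @ w)")
    case True
    then show ?thesis
      using has_long_square_imp_not_long_square_free by (metis suffixI)
  next
    case False
    have "c = 1 \<or> c = 2"
      using snoc.prems(2) by auto
    then have "fold_search (length vs) (c # w)"
      using snoc.prems(1) False by (auto simp: fold_search.simps[of "Suc _"])
    with snoc.IH[of "c # w"] snoc.prems(2) show ?thesis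
      by simp
  qed
qed

text \<open>This is the finite search itself, evaluated by rewriting inside the logic.\<close>

lemma fold_search_9: "fold_search 9 []"
  by code_simp

lemma binary_word_folds_to_long_square:
  assumes "length ws = 9" and "set ws \<subseteq> {1..2::nat}"
  obtains u where "u \<noteq> []" and "suffix u ws" and "\<not> long_square_free (rev (tl u) @ u)"
proof -
  obtain u where u: "suffix u ws" "\<not> long_square_free (rev (tl u) @ u)"
    using fold_search_sound[of ws "[]"] fold_search_9 assms by auto
  \<comment> \<open>The empty suffix folds to the empty word, which has no long square; so
    \<open>u\<close> is nonempty and has a first letter to serve as the turning point.\<close>
  moreover have "long_square_free ([] :: nat list)"
    by (auto simp: long_square_free_def long_square_def)
  ultimately show thesis
    using that[of u] by (cases "u = []") simp_all
qed

section \<open>Generations of a rooted graph\<close>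

locale rooted_graph = pair_bidirected_digraph G for G :: "'a pair_pre_digraph" +
  fixes r :: 'a
  assumes root_in_verts: "r \<in> pverts G"
    and connected_graph: "connected (with_proj G)"
begin

lemma vwalk_iff_successively:
  "vwalk p (with_proj G) \<longleftrightarrow>
     p \<noteq> [] \<and> set p \<subseteq> pverts G \<and> successively (\<lambda>x y. (x, y) \<in> parcs G) p"
  by (induction p rule: induct_list012) (auto simp: vwalk_def)

lemma vwalk_rev: "vwalk p (with_proj G) \<Longrightarrow> vwalk (rev p) (with_proj G)"
  by (auto simp: vwalk_iff_successively arcs_symmetric elim: successively_mono)

lemma graph_dist_le:
  assumes "vwalk p (with_proj G)"
  shows "graph_dist G (hd p) (last p) \<le> length p - 1"
  unfolding graph_dist_def by (rule Least_le) (use assms in auto)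

lemma shortest_walk:
  assumes "v \<in> pverts G"
  obtains p where "vwalk p (with_proj G)" "hd p = r" "last p = v"
    "length p = Suc (graph_dist G r v)"
proof -
  have "strongly_connected (with_proj G)"
    using symmetric_connected_imp_strongly_connected sym_arcs connected_graph by blast
  then have "r \<rightarrow>\<^sup>*\<^bsub>with_proj G\<^esub> v"
    using assms root_in_verts by (auto simp: strongly_connected_def)
  then obtain q where "vwalk q (with_proj G)" "hd q = r" "last q = v"
    by (auto simp: reachable_vwalk_conv)
  then have "\<exists>k p. vwalk p (with_proj G) \<and> hd p = r \<and> last p = v \<and> vwalk_length p = k"
    by blast
  then have "\<exists>p. vwalk p (with_proj G) \<and> hd p = r \<and> last p = v \<and>
      vwalk_length p = graph_dist G r v"
    unfolding graph_dist_def by (rule LeastI_ex)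
  then obtain p where p: "vwalk p (with_proj G)" "hd p = r" "last p = v"
    "length p - 1 = graph_dist G r v"
    by auto
  moreover from p(1) have "p \<noteq> []"
    by (simp add: vwalk_def)
  then have "length p = Suc (length p - 1)"
    by simp
  ultimately show thesis
    using that by simp
qed

text \<open>On a shortest walk from \<open>r\<close> the prefix ending at position \<open>i\<close>
  bounds the distance of that vertex by \<open>i\<close>, so only the last vertex can be as far away
  as \<open>v\<close>. Shortcutting the walk to a path adds no vertices.\<close>

lemma descending_path:
  assumes "v \<in> pverts G"
  obtains p where "vpath p (with_proj G)" "hd p = r" "last p = v"
    "\<And>w. w \<in> set p \<Longrightarrow> w = v \<or> graph_dist G r w < graph_dist G r v"
proof -
  obtain q where q: "vwalk q (with_proj G)" "hd q = r" "last q = v"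
    "length q = Suc (graph_dist G r v)"
    using shortest_walk[OF assms] .
  have "w = v \<or> graph_dist G r w < graph_dist G r v" if "w \<in> set q" for w
  proof -
    from that obtain i where i: "i < length q" "w = q ! i"
      by (auto simp: in_set_conv_nth)
    have "q = take (Suc i) q @ drop (Suc i) q"
      by simp
    with q(1) have "vwalk (take (Suc i) q) (with_proj G)"
      unfolding vwalk_iff_successively
      by (metis Un_subset_iff set_append successively_append_iff take_eq_Nil nat.distinct(1))
    moreover have "hd (take (Suc i) q) = r" "last (take (Suc i) q) = w"
      using i q by (auto simp: take_Suc_conv_app_nth hd_append hd_conv_nth)
    ultimately have "graph_dist G r w \<le> i"
      using graph_dist_le[of "take (Suc i) q"] i by auto
    moreover have "w = v" if "i = graph_dist G r v"
      using that q i by (metis diff_Suc_1 last_conv_nth length_0_conv nat.distinct(1))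
    ultimately show ?thesis
      using i q(4) by linarith
  qed
  moreover have "set (vwalk_to_vpath q) \<subseteq> set q"
    using vwalk_to_vpath_subset by fast
  moreover have "q \<noteq> []"
    using q by auto
  ultimately show thesis
    using that[of "vwalk_to_vpath q"] q
    by (auto simp: vwalk_to_vpath_hd vwalk_to_vpath_last vwalk_to_vpath_vpath)
qed

lemma root_in_generation_0: "r \<in> generation G r 0"
  using graph_dist_le[of "[r]"] root_in_verts by (simp add: generation_def)

text \<open>If the descending path from \<open>r\<close> to \<open>w\<close> avoided
  \<open>v\<close>, its reverse preceded by \<open>v\<close> would be a path from \<open>v\<close>
  to \<open>r\<close> through \<open>w\<close>, which \<open>children\<close> forbids. So
  \<open>v\<close> lies on it and is closer to \<open>r\<close> than \<open>w\<close>; the edge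
  bounds the difference by one.\<close>

lemma children_in_generation_Suc:
  assumes "v \<in> generation G r j" and "w \<in> children G r v"
  shows "w \<in> generation G r (Suc j)"
proof -
  have v: "v \<in> pverts G" "graph_dist G r v = j" and arc: "(v, w) \<in> parcs G"
    using assms by (auto simp: generation_def children_def)
  then have w: "w \<in> pverts G"
    using in_arcsD2 by blast
  have "v \<noteq> w"
    using arc pair_no_loops by fastforce
  obtain p where p: "vpath p (with_proj G)" "hd p = r" "last p = w"
    "\<And>x. x \<in> set p \<Longrightarrow> x = w \<or> graph_dist G r x < graph_dist G r w"
    using descending_path[OF w] by blast
  have "p \<noteq> []"
    using p(1) by (auto simp: vpath_def vwalk_def)
  have "v \<in> set p"
  proof (rule ccontr)
    assume "v \<notin> set p"
    then have "vpath (v # rev p) (with_proj G)"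
      using p(1,3) arc v \<open>p \<noteq> []\<close> vwalk_rev[of p]
      by (auto simp: vpath_def hd_rev intro!: vwalk_consI)
    moreover have "last (v # rev p) = r" "w \<in> set (v # rev p)"
      using p(2,3) \<open>p \<noteq> []\<close> by (auto simp: last_rev)
    ultimately show False
      using assms(2) unfolding children_def
      by (metis (mono_tags, lifting) list.sel(1) mem_Collect_eq)
  qed
  then have "j < graph_dist G r w"
    using p(4)[of v] \<open>v \<noteq> w\<close> v by auto
  moreover obtain q where q: "vwalk q (with_proj G)" "hd q = r" "last q = v" "length q = Suc j"
    using shortest_walk[OF v(1)] v(2) by metis
  then have "vwalk (q @ [w]) (with_proj G)"
    using arc w by (auto simp: vwalk_iff_successively successively_append_iff)
  then have "graph_dist G r w \<le> Suc j"
    using graph_dist_le[of "q @ [w]"] q by (cases q) auto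
  ultimately show ?thesis
    using w by (simp add: generation_def)
qed

text \<open>
  If \<open>z\<close> were a child of both \<open>x\<close> and \<open>x'\<close>, then a path from \<open>x\<close> to the root would lead
  through \<open>z\<close> and \<open>x'\<close>, so \<open>z\<close> would not be a child of \<open>x\<close>.
\<close>
lemma parent_unique:
  assumes "x \<in> generation G r j" "x' \<in> generation G r j"
    and "z \<in> children G r x" "z \<in> children G r x'"
  shows "x = x'"
proof (rule ccontr)
  assume "x \<noteq> x'"
  have x: "x \<in> pverts G" "x' \<in> pverts G" "graph_dist G r x = j" "graph_dist G r x' = j"
    and z: "z \<in> pverts G" "graph_dist G r z = Suc j"
    using assms children_in_generation_Suc by (auto simp: generation_def)
  have arcs: "(x, z) \<in> parcs G" "(z, x') \<in> parcs G"
    using assms arcs_symmetric by (auto simp: children_def)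
  obtain p where p: "vpath p (with_proj G)" "hd p = r" "last p = x'"
    "\<And>w. w \<in> set p \<Longrightarrow> w = x' \<or> graph_dist G r w < graph_dist G r x'"
    using descending_path[OF x(2)] by blast
  have "p \<noteq> []"
    using p(1) by (auto simp: vpath_def vwalk_def)
  have "x \<notin> set p" "z \<notin> set p" "x \<noteq> z"
    using p(4)[of x] p(4)[of z] x z \<open>x \<noteq> x'\<close> by auto
  then have "vpath (x # z # rev p) (with_proj G)"
    using p(1,3) arcs x z \<open>p \<noteq> []\<close> vwalk_rev[of p]
    by (auto simp: vpath_def hd_rev intro!: vwalk_consI)
  moreover have "last (x # z # rev p) = r"
    using p(2) \<open>p \<noteq> []\<close> by (auto simp: last_rev)
  ultimately show False
    using assms(3) unfolding children_def
    by (metis (mono_tags, lifting) list.sel(1) list.set_intros mem_Collect_eq)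
qed

section \<open>Paths leading from parent to child\<close>

definition descending :: "'a list \<Rightarrow> bool" where
  "descending p \<longleftrightarrow> successively (\<lambda>x y. y \<in> children G r x) p"

lemma descending_nth_generation:
  assumes "descending p" and "hd p \<in> generation G r j" and "i < length p"
  shows "p ! i \<in> generation G r (j + i)"
  using assms(3)
proof (induction i)
  case 0
  then show ?case
    using assms(2) by (simp add: hd_conv_nth)
next
  case (Suc i)
  then have "p ! Suc i \<in> children G r (p ! i)"
    using assms(1) successively_nth unfolding descending_def by fastforce
  with Suc show ?case
    using children_in_generation_Suc by simp
qed

lemma generation_unique: "v \<in> generation G r i \<Longrightarrow> v \<in> generation G r j \<Longrightarrow> i = j"
  by (simp add: generation_def)

lemma descending_distinct:
  assumes "descending p" and "hd p \<in> generation G r j"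
  shows "distinct p"
  unfolding distinct_conv_nth
  using descending_nth_generation[OF assms] generation_unique by (metis add_left_cancel)

text \<open>The generation of a vertex determines its position in the list, so a common vertex would
  sit at the same position in both. Uniqueness of parents carries the difference of the heads down
  to every position.\<close>

lemma descending_disjoint:
  assumes "descending p" "descending q"
    and "hd p \<in> generation G r j" "hd q \<in> generation G r j" "hd p \<noteq> hd q"
  shows "set p \<inter> set q = {}"
proof -
  have neq: "p ! i \<noteq> q ! i" if "i < length p" "i < length q" for i
    using that
  proof (induction i)
    case 0
    then show ?case
      using assms(5) by (simp add: hd_conv_nth)
  next
    case (Suc i)
    then have "p ! Suc i \<in> children G r (p ! i)" "q ! Suc i \<in> children G r (q ! i)"
      using assms(1,2) successively_nth unfolding descending_def by fastforce+
    moreover have "p ! i \<in> generation G r (j + i)" "q ! i \<in> generation G r (j + i)"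
      using Suc.prems assms descending_nth_generation by auto
    ultimately show ?case
      using Suc parent_unique by fastforce
  qed
  have False if "i < length p" "k < length q" "p ! i = q ! k" for i k
    using descending_nth_generation[OF assms(1,3) that(1)]
      descending_nth_generation[OF assms(2,4) that(2)] generation_unique neq that
    by (metis add_left_cancel)
  then show ?thesis
    by (metis disjoint_iff in_set_conv_nth)
qed

lemma descending_vwalk:
  assumes "descending p" and "p \<noteq> []" and "hd p \<in> generation G r j"
  shows "vwalk p (with_proj G)"
  unfolding vwalk_iff_successively
proof (intro conjI)
  show "set p \<subseteq> pverts G"
    using descending_nth_generation[OF assms(1,3)] by (auto simp: in_set_conv_nth generation_def)
  show "successively (\<lambda>x y. (x, y) \<in> parcs G) p"
    using assms(1) unfolding descending_def by (rule successively_mono) (simp add: children_def)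
qed (rule assms)

section \<open>Uniformly coloured binary subtrees\<close>

text \<open>Letter \<open>i\<close> of the word is the colour of the \<open>i\<close>-th level below
  \<open>v\<close>, counted from 0. The disjunct \<open>ws = []\<close> ends the subtree at its last
  level, where a vertex may be a leaf.\<close>

fun uniform_subtree :: "('a \<Rightarrow> 'c) \<Rightarrow> 'c list \<Rightarrow> 'a \<Rightarrow> bool" where
  "uniform_subtree \<chi> [] v \<longleftrightarrow> True"
| "uniform_subtree \<chi> (c # ws) v \<longleftrightarrow> \<chi> v = c \<and>
     (ws = [] \<or> (\<exists>x\<in>children G r v. \<exists>y\<in>children G r v.
        x \<noteq> y \<and> uniform_subtree \<chi> ws x \<and> uniform_subtree \<chi> ws y))"

lemma uniform_subtree_descending:
  assumes "uniform_subtree \<chi> ws v" and "ws \<noteq> []"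
  shows "\<exists>p. hd p = v \<and> descending p \<and> map \<chi> p = ws"
  using assms
proof (induction ws arbitrary: v)
  case (Cons c ws)
  show ?case
  proof (cases "ws = []")
    case True
    then show ?thesis
      using Cons.prems by (intro exI[of _ "[v]"]) (simp add: descending_def)
  next
    case False
    then obtain x where x: "x \<in> children G r v" "uniform_subtree \<chi> ws x"
      using Cons.prems by auto
    then obtain p where p: "hd p = x" "descending p" "map \<chi> p = ws"
      using Cons.IH False by blast
    then show ?thesis
      using x Cons.prems
      by (intro exI[of _ "v # p"]) (auto simp: descending_def successively_Cons)
  qed
qed simp

text \<open>Dropping the first letter of the word amounts to passing to a child.\<close>

lemma uniform_subtree_suffix:
  assumes "uniform_subtree \<chi> ws v" and "v \<in> generation G r j" and "suffix u ws" and "u \<noteq> []"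
  shows "\<exists>t i. t \<in> generation G r i \<and> uniform_subtree \<chi> u t"
  using assms
proof (induction ws arbitrary: v j)
  case (Cons c ws)
  show ?case
  proof (cases "u = c # ws")
    case True
    then show ?thesis
      using Cons.prems by blast
  next
    case False
    then have "suffix u ws"
      using Cons.prems(3) by (simp add: suffix_Cons)
    moreover from this obtain x where "x \<in> children G r v" "uniform_subtree \<chi> ws x"
      using Cons.prems by auto
    ultimately show ?thesis
      using Cons.IH children_in_generation_Suc Cons.prems by blast
  qed
qed simp

lemma uniform_subtree_folded_path:
  assumes "uniform_subtree \<chi> u t" and "t \<in> generation G r j" and "u \<noteq> []"
  obtains p where "vpath p (with_proj G)" and "map \<chi> p = rev (tl u) @ u"
proof -
  obtain c ws where u: "u = c # ws"
    using assms(3) by (cases u) auto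
  show thesis
  proof (cases "ws = []")
    case True
    then show thesis
      using that[of "[t]"] assms u by (auto simp: vpath_def generation_def)
  next
    case False
    then obtain x y where xy: "x \<in> children G r t" "y \<in> children G r t" "x \<noteq> y"
      "uniform_subtree \<chi> ws x" "uniform_subtree \<chi> ws y" and t: "\<chi> t = c"
      using assms(1) u by auto
    obtain p where p: "hd p = x" "descending p" "map \<chi> p = ws"
      using uniform_subtree_descending xy False by blast
    obtain q where q: "hd q = y" "descending q" "map \<chi> q = ws"
      using uniform_subtree_descending xy False by blast
    have tp: "descending (t # p)" "descending (t # q)"
      using p q xy by (auto simp: descending_def successively_Cons)
    have gen: "hd p \<in> generation G r (Suc j)" "hd q \<in> generation G r (Suc j)"
      using p q xy assms(2) children_in_generation_Suc by auto
    \<comment> \<open>The two branches start at different children of \<open>t\<close>, hence never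
      meet; \<open>t\<close> is on neither because \<open>t # p\<close> and \<open>t # q\<close>
      descend.\<close>
    have "set p \<inter> set q = {}"
      using descending_disjoint p q gen xy by blast
    moreover have "distinct (t # p)" "distinct (t # q)"
      using descending_distinct tp assms(2) by fastforce+
    ultimately have "distinct (rev p @ t # q)"
      by auto
    moreover have "vwalk (rev p @ t # q) (with_proj G)"
    proof -
      have "vwalk (t # p) (with_proj G)" "vwalk (t # q) (with_proj G)"
        using descending_vwalk[OF tp(1)] descending_vwalk[OF tp(2)] assms(2) by simp_all
      moreover from this(1) have "vwalk (rev p @ [t]) (with_proj G)"
        using vwalk_rev[of "t # p"] by simp
      ultimately show ?thesis
        by (auto simp: vwalk_iff_successively successively_append_iff)
    qed
    ultimately have "vpath (rev p @ t # q) (with_proj G)"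
      by blast
    moreover have "map \<chi> (rev p @ t # q) = rev (tl u) @ u"
      using p q t u by (simp flip: rev_map)
    ultimately show thesis
      by (rule that)
  qed
qed

lemma uniform_subtree_exists:
  fixes \<chi> :: "'a \<Rightarrow> nat"
  assumes \<chi>: "\<And>v. v \<in> pverts G \<Longrightarrow> \<chi> v \<in> {1..2}"
    and card_children:
      "\<And>j v. j < n \<Longrightarrow> v \<in> generation G r j \<Longrightarrow> card (children G r v) = 2 ^ (n - j) + 1"
    and "v \<in> generation G r j" and "j + k \<le> n"
  shows "\<exists>ws. length ws = Suc k \<and> set ws \<subseteq> {1..2} \<and> uniform_subtree \<chi> ws v"
  using assms(3,4)
proof (induction k arbitrary: j v)
  case 0
  then show ?case
    using \<chi>[of v] by (intro exI[of _ "[\<chi> v]"]) (auto simp: generation_def)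
next
  case (Suc k)
  let ?C = "children G r v"
  let ?W = "{ws. set ws \<subseteq> {1..2::nat} \<and> length ws = Suc k}"
  have "\<forall>x\<in>?C. \<exists>ws. ws \<in> ?W \<and> uniform_subtree \<chi> ws x"
    using Suc.IH[of _ "Suc j"] Suc.prems children_in_generation_Suc by fastforce
  then obtain f where f: "\<And>x. x \<in> ?C \<Longrightarrow> f x \<in> ?W \<and> uniform_subtree \<chi> (f x) x"
    by metis
  have W: "finite ?W" "card ?W = 2 ^ Suc k"
    using finite_lists_length_eq[of "{1..2::nat}" "Suc k"]
      card_lists_length_eq[of "{1..2::nat}" "Suc k"] by auto
  \<comment> \<open>There are \<open>2 ^ Suc k\<close> words available to the children, and
    \<open>j + Suc k \<le> n\<close>; the extra \<open>+ 1\<close> in the number of children makes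
    the inequality strict even when \<open>Suc k = n - j\<close>.\<close>
  have "(2::nat) ^ Suc k \<le> 2 ^ (n - j)"
    using Suc.prems by (intro power_increasing) auto
  then have "card ?W < card ?C"
    using W(2) card_children[OF _ Suc.prems(1)] Suc.prems(2) by simp
  moreover have "f ` ?C \<subseteq> ?W"
    using f by blast
  ultimately have "card (f ` ?C) < card ?C"
    using W(1) card_mono[of ?W "f ` ?C"] by linarith
  then have "\<not> inj_on f ?C"
    by (rule pigeonhole)
  then obtain x y where "x \<in> ?C" "y \<in> ?C" "x \<noteq> y" "f x = f y"
    by (auto simp: inj_on_def)
  moreover from this have "uniform_subtree \<chi> (f x) x" "uniform_subtree \<chi> (f x) y"
    using f by metis+
  ultimately have "uniform_subtree \<chi> (\<chi> v # f x) v"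
    by auto
  moreover have "\<chi> v \<in> {1..2}"
    using \<chi> Suc.prems(1) by (simp add: generation_def)
  ultimately show ?case
    using f[OF \<open>x \<in> ?C\<close>] by (intro exI[of _ "\<chi> v # f x"]) auto
qed

end

theorem proposition3p4:
  fixes n :: nat and G :: "'a pair_pre_digraph" and r :: 'a
  assumes "n \<ge> 8" and "tyler_tree n G r"
  shows "\<not> long_repetition_free_colorable 2 G"
proof
  assume "long_repetition_free_colorable 2 G"
  then obtain \<chi> where \<chi>: "\<And>v. v \<in> pverts G \<Longrightarrow> \<chi> v \<in> {1..2::nat}"
    and free: "\<And>p. vpath p (with_proj G) \<Longrightarrow> long_square_free (map \<chi> p)"
    unfolding long_repetition_free_colorable_def by blast
  have T: "undirected_tree G" "r \<in> pverts G"
    "\<And>j v. j < n \<Longrightarrow> v \<in> generation G r j \<Longrightarrow> card (children G r v) = 2 ^ (n - j) + 1"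
    using assms(2) unfolding tyler_tree_def by blast+
  interpret pair_bidirected_digraph G
    using T(1) by (simp add: undirected_tree_def)
  interpret rooted_graph G r
    using T(1,2) by unfold_locales (auto simp: undirected_tree_def)
  \<comment> \<open>Height 8 fits below the root since \<open>n \<ge> 8\<close>; its levels 0 to 8
    give the 9 letters covered by the search.\<close>
  obtain ws where ws: "length ws = 9" "set ws \<subseteq> {1..2}" "uniform_subtree \<chi> ws r"
    using uniform_subtree_exists[of \<chi> n r 0 8] \<chi> T(3) root_in_generation_0 assms(1) by auto
  obtain u where u: "u \<noteq> []" "suffix u ws" "\<not> long_square_free (rev (tl u) @ u)"
    using binary_word_folds_to_long_square ws(1,2) by blast
  obtain t i where "t \<in> generation G r i" "uniform_subtree \<chi> u t"
    using uniform_subtree_suffix ws(3) root_in_generation_0 u by blast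
  then obtain p where "vpath p (with_proj G)" "map \<chi> p = rev (tl u) @ u"
    using uniform_subtree_folded_path u(1) by blast
  then show False
    using free u(3) by metis
qed

end
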